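(* Let $A \in \mathbb{R}^{m_1m_2 \times n_1n_2}$, $B_1 \in \mathbb{R}^{m_1 \times p_1}$, $B_2 \in \mathbb{R}^{m_2 \times p_2}$, $C_1 \in \mathbb{R}^{q_1 \times n_1}$, $C_2 \in \mathbb{R}^{q_2 \times n_2}$, and let $r$ be a positive integer. Then $X_* \in \mathbb{R}^{p_1p_2 \times q_1q_2}$ is a solution to $$\min_{\operatorname{rank}_\otimes(X) \le r} \lVert A- (B_1 \otimes B_2)X(C_1 \otimes C_2) \rVert_{\mathsf F}$$ if and only if $\mathcal{R}(X_* )$ is a solution to $$\min_{\operatorname{rank}(\widehat{X})\le r} \lVert \mathcal{R}(A)- (C_2^{\mathsf T} \otimes B_2)\widehat{X}(C_1 \otimes B_1^{\mathsf T}) \rVert_{\mathsf F},$$ where $X$ ranges over $\mathbb{R}^{p_1p_2 \times q_1q_2}$ and $\widehat{X}$ over $\mathbb{R}^{p_2q_2 \times p_1q_1}$.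
   Context: $\otimes$ is the Kronecker product, $\lVert\cdot\rVert_{\mathsf F}$ the Frobenius norm, and $\operatorname{vec}$ stacks the columns of a matrix into a column vector. The Kronecker rank of $X \in \mathbb{R}^{p_1p_2 \times q_1q_2}$ (with respect to the given factorizations of the dimensions) is $$\operatorname{rank}_\otimes (X) = \min \{ r : X = Y_1 \otimes Z_1 + \dots + Y_r \otimes Z_r\},$$ the minimum being over $Y_1,\dots,Y_r\in \mathbb{R}^{p_1 \times q_1}$, $Z_1,\dots,Z_r \in \mathbb{R}^{p_2 \times q_2}$. For any dimensions $a_1,a_2,b_1,b_2$, the rearrangement operator $\mathcal{R} : \mathbb{R}^{a_1 a_2 \times b_1 b_2} \to \mathbb{R}^{a_2 b_2 \times a_1 b_1}$ is the unique linear operator satisfying $\mathcal{R}(Y \otimes Z) = \operatorname{vec}(Z)\operatorname{vec}(Y)^{\mathsf T}$ for all $Y \in \mathbb{R}^{a_1 \times b_1}$, $Z \in \mathbb{R}^{a_2 \times b_2}$. It is applied to $A$ with $(a_1,a_2,b_1,b_2)=(m_1,m_2,n_1,n_2)$ and to $X$ with $(a_1,a_2,b_1,b_2)=(p_1,p_2,q_1,q_2)$. *)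

theory Defs
  imports "HOL-Analysis.Analysis"
begin

text \<open>
  A matrix with \<open>m\<^sub>1m\<^sub>2\<close> rows and \<open>n\<^sub>1n\<^sub>2\<close> columns, with these factorizations of the
  dimensions, is an element of \<open>real^('n1 \<times> 'n2)^('m1 \<times> 'm2)\<close>: a factored dimension is the
  product of two finite index types. The usual flat matrices are recovered by enumerating
  each factor and ordering pairs lexicographically, with the first component most significant.
\<close>

definition kron :: "real^'n1^'m1 \<Rightarrow> real^'n2^'m2 \<Rightarrow> real^('n1 \<times> 'n2)^('m1 \<times> 'm2)"
    (infixl "\<otimes>\<^sub>K" 75) where
  "Y \<otimes>\<^sub>K Z = (\<chi> i j. Y $ fst i $ fst j * Z $ snd i $ snd j)"

definition frobenius_norm :: "real^'n^'m \<Rightarrow> real" where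
  "frobenius_norm A = sqrt (\<Sum>i\<in>UNIV. \<Sum>j\<in>UNIV. (A $ i $ j)\<^sup>2)"

lemma frobenius_norm_eq_norm: "frobenius_norm A = norm A"
  by (simp add: frobenius_norm_def norm_vec_def L2_set_def sum_nonneg)

text \<open>
  The result is a one-column matrix. The column index is the first component of the row
  index, so that in lexicographic order the columns of the argument are stacked one below
  the other.
\<close>

definition vec_cols :: "real^'n^'m \<Rightarrow> real^1^('n \<times> 'm)" where
  "vec_cols A = columnvector (\<chi> k. A $ snd k $ fst k)"

definition kron_rank :: "real^('q1::finite \<times> 'q2::finite)^('p1::finite \<times> 'p2::finite) \<Rightarrow> nat" where
  "kron_rank X =
    (LEAST r. \<exists>(Y :: nat \<Rightarrow> real^'q1^'p1) (Z :: nat \<Rightarrow> real^'q2^'p2).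
       X = (\<Sum>k<r. Y k \<otimes>\<^sub>K Z k))"

text \<open>The definite description is justified by \<open>rearrange_ex1\<close> below.\<close>

definition rearrange ::
  "real^('b1::finite \<times> 'b2::finite)^('a1::finite \<times> 'a2::finite) \<Rightarrow> real^('b1::finite \<times> 'a1::finite)^('b2::finite \<times> 'a2::finite)" where
  "rearrange =
    (THE R. linear R \<and>
       (\<forall>(Y :: real^'b1^'a1) (Z :: real^'b2^'a2).
          R (Y \<otimes>\<^sub>K Z) = vec_cols Z ** transpose (vec_cols Y)))"

lemma Basis_kron:
  fixes b :: "real^('b1::finite \<times> 'b2::finite)^('a1::finite \<times> 'a2::finite)"
  assumes "b \<in> Basis"
  obtains Y :: "real^'b1^'a1" and Z :: "real^'b2^'a2" where "b = Y \<otimes>\<^sub>K Z"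
proof -
  obtain i j where b: "b = axis i (axis j 1)"
    using assms by (auto simp: Basis_vec_def)
  have "b = axis (fst i) (axis (fst j) 1) \<otimes>\<^sub>K axis (snd i) (axis (snd j) 1)"
    unfolding b kron_def vec_eq_iff by (auto simp: axis_def prod_eq_iff)
  then show thesis by (rule that)
qed

lemma rearrange_ex1:
  "\<exists>!R :: real^('b1::finite \<times> 'b2::finite)^('a1::finite \<times> 'a2::finite) \<Rightarrow> real^('b1::finite \<times> 'a1::finite)^('b2::finite \<times> 'a2::finite).
     linear R \<and>
     (\<forall>(Y :: real^'b1^'a1) (Z :: real^'b2^'a2).
        R (Y \<otimes>\<^sub>K Z) = vec_cols Z ** transpose (vec_cols Y))"
proof (rule ex_ex1I)
  let ?R = "\<lambda>X :: real^('b1::finite \<times> 'b2::finite)^('a1::finite \<times> 'a2::finite).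
    (\<chi> k l. X $ (snd l, snd k) $ (fst l, fst k)) :: real^('b1::finite \<times> 'a1::finite)^('b2::finite \<times> 'a2::finite)"
  have "linear ?R"
    by (rule linearI) (simp_all add: vec_eq_iff)
  moreover have "?R (Y \<otimes>\<^sub>K Z) = vec_cols Z ** transpose (vec_cols Y)" for Y Z
    by (simp add: vec_eq_iff kron_def vec_cols_def columnvector_def transpose_def
        matrix_matrix_mult_def)
  ultimately show "\<exists>R :: real^('b1::finite \<times> 'b2::finite)^('a1::finite \<times> 'a2::finite) \<Rightarrow> real^('b1::finite \<times> 'a1::finite)^('b2::finite \<times> 'a2::finite).
     linear R \<and>
     (\<forall>(Y :: real^'b1^'a1) (Z :: real^'b2^'a2).
        R (Y \<otimes>\<^sub>K Z) = vec_cols Z ** transpose (vec_cols Y))"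
    by blast
next
  fix R S :: "real^('b1::finite \<times> 'b2::finite)^('a1::finite \<times> 'a2::finite) \<Rightarrow> real^('b1::finite \<times> 'a1::finite)^('b2::finite \<times> 'a2::finite)"
  assume R: "linear R \<and> (\<forall>(Y :: real^'b1^'a1) (Z :: real^'b2^'a2).
      R (Y \<otimes>\<^sub>K Z) = vec_cols Z ** transpose (vec_cols Y))"
    and S: "linear S \<and> (\<forall>(Y :: real^'b1^'a1) (Z :: real^'b2^'a2).
      S (Y \<otimes>\<^sub>K Z) = vec_cols Z ** transpose (vec_cols Y))"
  show "R = S"
  proof (rule linear_eq_stdbasis)
    show "R b = S b" if "b \<in> Basis" for b
      using Basis_kron[OF that] R S by metis
  qed (use R S in auto)
qed

lemma kron_rank_attained:
  fixes X :: "real^('q1::finite \<times> 'q2::finite)^('p1::finite \<times> 'p2::finite)"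
  shows "\<exists>(Y :: nat \<Rightarrow> real^'q1^'p1) (Z :: nat \<Rightarrow> real^'q2^'p2).
    X = (\<Sum>k<kron_rank X. Y k \<otimes>\<^sub>K Z k)"
proof -
  let ?B = "Basis :: (real^('q1::finite \<times> 'q2::finite)^('p1::finite \<times> 'p2::finite)) set"
  obtain h where h: "bij_betw h {..<card ?B} ?B"
    using ex_bij_betw_nat_finite[OF finite_Basis] by (metis atLeast0LessThan)
  have "\<exists>Y Z. (X \<bullet> b) *\<^sub>R b = (Y :: real^'q1^'p1) \<otimes>\<^sub>K (Z :: real^'q2^'p2)" if "b \<in> ?B" for b
  proof -
    obtain Y :: "real^'q1^'p1" and Z :: "real^'q2^'p2" where "b = Y \<otimes>\<^sub>K Z"
      using Basis_kron[OF \<open>b \<in> ?B\<close>] .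
    then have "(X \<bullet> b) *\<^sub>R b = ((X \<bullet> b) *\<^sub>R Y) \<otimes>\<^sub>K Z"
      by (simp add: vec_eq_iff kron_def)
    then show ?thesis by blast
  qed
  then obtain Y :: "_ \<Rightarrow> real^'q1^'p1" and Z :: "_ \<Rightarrow> real^'q2^'p2"
    where YZ: "\<And>b. b \<in> ?B \<Longrightarrow> (X \<bullet> b) *\<^sub>R b = Y b \<otimes>\<^sub>K Z b"
    by metis
  have "X = (\<Sum>b\<in>?B. Y b \<otimes>\<^sub>K Z b)"
    using euclidean_representation[of X] YZ by simp
  also have "\<dots> = (\<Sum>k<card ?B. Y (h k) \<otimes>\<^sub>K Z (h k))"
    by (rule sum.reindex_bij_betw[OF h, symmetric])
  finally have "\<exists>r (Y :: nat \<Rightarrow> real^'q1^'p1) (Z :: nat \<Rightarrow> real^'q2^'p2).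
      X = (\<Sum>k<r. Y k \<otimes>\<^sub>K Z k)"
    by (intro exI)
  then show ?thesis
    unfolding kron_rank_def by (rule LeastI_ex)
qed

end

theory Submission
  imports Defs
begin

text \<open>
  In terms of entries, rearrangement moves the entry of \<open>X\<close> in row \<open>(i\<^sub>1, i\<^sub>2)\<close> and column
  \<open>(j\<^sub>1, j\<^sub>2)\<close> to row \<open>(j\<^sub>2, i\<^sub>2)\<close> and column \<open>(j\<^sub>1, i\<^sub>1)\<close>. So it only permutes the positions of the
  entries: it is a linear bijection that preserves the Frobenius norm. The theorem holds
  because this bijection carries the first problem to the second, constraint to constraint
  and objective to objective.

  Constraint: a Kronecker product is rearranged to a product of a column and a row, and every
  such product arises in this way. Hence \<open>X\<close> is a sum of \<open>r\<close> Kronecker products if and only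
  if \<open>rearrange X\<close> is a sum of \<open>r\<close> products of a column and a row, that is, a matrix of rank
  at most \<open>r\<close> (\<open>rank_le_iff_sum_outer\<close>). This gives \<open>rank_rearrange_le_iff\<close>.

  Objective: for \<open>X = Y \<otimes>\<^sub>K Z\<close>, the product \<open>(B\<^sub>1 \<otimes>\<^sub>K B\<^sub>2) X (C\<^sub>1 \<otimes>\<^sub>K C\<^sub>2)\<close> is the Kronecker product
  of \<open>B\<^sub>1 Y C\<^sub>1\<close> and \<open>B\<^sub>2 Z C\<^sub>2\<close>. Its rearrangement is \<open>vec(B\<^sub>2 Z C\<^sub>2) vec(B\<^sub>1 Y C\<^sub>1)\<^sup>T\<close>, and the identity
  \<open>vec(B Z C) = (C\<^sup>T \<otimes>\<^sub>K B) vec(Z)\<close> moves the coefficient matrices outside. The Kronecker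
  products span, so by linearity \<open>rearrange_sandwich\<close> holds for every \<open>X\<close>.
\<close>

section \<open>Kronecker products and vectorization\<close>

lemma sum_UNIV_prod:
  "(\<Sum>p\<in>(UNIV :: ('a::finite \<times> 'b::finite) set). f p) = (\<Sum>a\<in>UNIV. \<Sum>b\<in>UNIV. f (a, b))"
  by (simp add: sum.cartesian_product)

lemma kron_mult: "(A \<otimes>\<^sub>K B) ** (C \<otimes>\<^sub>K D) = (A ** C) \<otimes>\<^sub>K (B ** D)"
  by (simp add: vec_eq_iff kron_def matrix_matrix_mult_def sum_product sum_UNIV_prod
      mult.commute mult.left_commute)

lemma transpose_kron: "transpose (A \<otimes>\<^sub>K B) = transpose A \<otimes>\<^sub>K transpose B"
  by (simp add: vec_eq_iff kron_def transpose_def)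

lemma vec_cols_mult: "vec_cols (B ** Z ** C) = (transpose C \<otimes>\<^sub>K B) ** vec_cols Z"
  by (simp add: vec_eq_iff kron_def vec_cols_def columnvector_def matrix_matrix_mult_def
      transpose_def sum_UNIV_prod sum_distrib_left mult.commute mult.left_commute)

lemma vec_cols_unstack: "vec_cols (\<chi> i j. u $ (j, i)) = columnvector u"
  by (simp add: vec_cols_def vec_eq_iff columnvector_def)

section \<open>The rearrangement operator\<close>

lemma linear_rearrange: "linear rearrange"
  and rearrange_kron: "rearrange (Y \<otimes>\<^sub>K Z) = vec_cols Z ** transpose (vec_cols Y)"
  using theI'[OF rearrange_ex1] unfolding rearrange_def by blast+

text \<open>
  The entrywise map given by the right-hand side is linear and takes the prescribed values on Kronecker
  products, and these two properties determine the rearrangement operator.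
\<close>

lemma rearrange_nth:
  fixes X :: "real^('b1::finite \<times> 'b2::finite)^('a1::finite \<times> 'a2::finite)"
  shows "rearrange X $ k $ l = X $ (snd l, snd k) $ (fst l, fst k)"
proof -
  let ?R = "\<lambda>X :: real^('b1 \<times> 'b2)^('a1 \<times> 'a2).
    (\<chi> k l. X $ (snd l, snd k) $ (fst l, fst k)) :: real^('b1 \<times> 'a1)^('b2 \<times> 'a2)"
  have "linear ?R"
    by (rule linearI) (simp_all add: vec_eq_iff)
  moreover have "?R (Y \<otimes>\<^sub>K Z) = vec_cols Z ** transpose (vec_cols Y)"
    for Y :: "real^'b1^'a1" and Z :: "real^'b2^'a2"
    by (simp add: vec_eq_iff kron_def vec_cols_def columnvector_def transpose_def
        matrix_matrix_mult_def)
  ultimately have "rearrange = ?R"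
    using rearrange_ex1 linear_rearrange rearrange_kron by blast
  then have "rearrange X = ?R X" by (rule fun_cong)
  then show ?thesis by simp
qed

lemma inj_rearrange: "inj rearrange"
  by (rule injI) (auto simp: vec_eq_iff rearrange_nth)

lemma surj_rearrange: "surj rearrange"
proof (rule surjI)
  fix M :: "real^('b1::finite \<times> 'a1::finite)^('b2::finite \<times> 'a2::finite)"
  show "rearrange (\<chi> i j. M $ (snd j, snd i) $ (fst j, fst i)) = M"
    by (simp add: vec_eq_iff rearrange_nth)
qed

lemma frobenius_norm_rearrange: "frobenius_norm (rearrange X) = frobenius_norm X"
proof -
  let ?f = "\<lambda>a b c d. (X $ (a, b) $ (c, d))\<^sup>2"
  have "(\<Sum>i\<in>UNIV. \<Sum>j\<in>UNIV. (rearrange X $ i $ j)\<^sup>2)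
      = (\<Sum>d\<in>UNIV. \<Sum>b\<in>UNIV. \<Sum>c\<in>UNIV. \<Sum>a\<in>UNIV. ?f a b c d)"
    by (simp add: rearrange_nth sum_UNIV_prod)
  also have "\<dots> = (\<Sum>d\<in>UNIV. \<Sum>b\<in>UNIV. \<Sum>a\<in>UNIV. \<Sum>c\<in>UNIV. ?f a b c d)"
    by (intro sum.cong sum.swap refl)
  also have "\<dots> = (\<Sum>b\<in>UNIV. \<Sum>d\<in>UNIV. \<Sum>a\<in>UNIV. \<Sum>c\<in>UNIV. ?f a b c d)"
    by (rule sum.swap)
  also have "\<dots> = (\<Sum>b\<in>UNIV. \<Sum>a\<in>UNIV. \<Sum>d\<in>UNIV. \<Sum>c\<in>UNIV. ?f a b c d)"
    by (intro sum.cong sum.swap refl)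
  also have "\<dots> = (\<Sum>a\<in>UNIV. \<Sum>b\<in>UNIV. \<Sum>d\<in>UNIV. \<Sum>c\<in>UNIV. ?f a b c d)"
    by (rule sum.swap)
  also have "\<dots> = (\<Sum>a\<in>UNIV. \<Sum>b\<in>UNIV. \<Sum>c\<in>UNIV. \<Sum>d\<in>UNIV. ?f a b c d)"
    by (intro sum.cong sum.swap refl)
  also have "\<dots> = (\<Sum>i\<in>UNIV. \<Sum>j\<in>UNIV. (X $ i $ j)\<^sup>2)"
    by (simp add: sum_UNIV_prod)
  finally show ?thesis
    by (simp add: frobenius_norm_def)
qed

lemma linear_sandwich: "linear (\<lambda>X. P ** X ** Q)" for P :: "real^'a^'c" and Q :: "real^'d^'b"
  by (rule linearI)
    (simp_all add: vec_eq_iff matrix_matrix_mult_def sum_distrib_left sum_distrib_right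
      sum.distrib algebra_simps)

text \<open>
  Both sides are linear in \<open>X\<close>, and the standard basis consists of Kronecker products; for
  these the claim is the identity for vectorizing a product, applied to each factor.
\<close>

lemma rearrange_sandwich:
  fixes B1 :: "real^'p1::finite^'m1::finite" and B2 :: "real^'p2::finite^'m2::finite"
    and C1 :: "real^'n1::finite^'q1::finite" and C2 :: "real^'n2::finite^'q2::finite"
  shows "rearrange ((B1 \<otimes>\<^sub>K B2) ** X ** (C1 \<otimes>\<^sub>K C2))
    = (transpose C2 \<otimes>\<^sub>K B2) ** rearrange X ** (C1 \<otimes>\<^sub>K transpose B1)"
proof -
  let ?L = "\<lambda>X. rearrange ((B1 \<otimes>\<^sub>K B2) ** X ** (C1 \<otimes>\<^sub>K C2))"
  let ?R = "\<lambda>X. (transpose C2 \<otimes>\<^sub>K B2) ** rearrange X ** (C1 \<otimes>\<^sub>K transpose B1)"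
  have "?L = ?R"
  proof (rule linear_eq_stdbasis)
    show "linear ?L"
      using linear_compose[OF linear_sandwich linear_rearrange] by (simp add: o_def)
    show "linear ?R"
      using linear_compose[OF linear_rearrange linear_sandwich] by (simp add: o_def)
    fix b :: "real^('q1 \<times> 'q2)^('p1 \<times> 'p2)"
    assume "b \<in> Basis"
    then obtain Y :: "real^'q1^'p1" and Z :: "real^'q2^'p2" where b: "b = Y \<otimes>\<^sub>K Z"
      by (rule Basis_kron)
    have "?L b = vec_cols (B2 ** Z ** C2) ** transpose (vec_cols (B1 ** Y ** C1))"
      by (simp add: b kron_mult rearrange_kron)
    also have "\<dots> = ?R b"
      by (simp add: b rearrange_kron vec_cols_mult matrix_transpose_mul transpose_kron
          matrix_mul_assoc)
    finally show "?L b = ?R b" .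
  qed
  then show ?thesis by (rule fun_cong)
qed

section \<open>Rank and Kronecker rank\<close>

lemma outer_nth:
  "((columnvector u :: real^1^'m) ** transpose (columnvector v :: real^1^'n)) $ i $ j = u $ i * v $ j"
  by (simp add: matrix_matrix_mult_def columnvector_def transpose_def)

text \<open>
  The columns of a sum of \<open>r\<close> products \<open>u\<^sub>k v\<^sub>k\<^sup>T\<close> lie in the span of the \<open>r\<close> vectors \<open>u\<^sub>k\<close>.
  Conversely, if the rank is at most \<open>r\<close>, then a basis of the column space provides the \<open>u\<^sub>k\<close>,
  and the coordinates of the columns with respect to it are the entries of the \<open>v\<^sub>k\<close>.
\<close>

lemma rank_le_iff_sum_outer:
  fixes M :: "real^'n::finite^'m::finite"
  shows "rank M \<le> r \<longleftrightarrow> (\<exists>(u :: nat \<Rightarrow> real^'m) (v :: nat \<Rightarrow> real^'n).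
    M = (\<Sum>k<r. (columnvector (u k) :: real^1^'m) ** transpose (columnvector (v k))))"
proof
  assume "\<exists>(u :: nat \<Rightarrow> real^'m) (v :: nat \<Rightarrow> real^'n).
    M = (\<Sum>k<r. (columnvector (u k) :: real^1^'m) ** transpose (columnvector (v k)))"
  then obtain u :: "nat \<Rightarrow> real^'m" and v :: "nat \<Rightarrow> real^'n" where
    M: "M = (\<Sum>k<r. (columnvector (u k) :: real^1^'m) ** transpose (columnvector (v k)))"
    by blast
  have "column j M = (\<Sum>k<r. (v k $ j) *\<^sub>R u k)" for j
    by (simp add: M vec_eq_iff column_def outer_nth mult.commute)
  moreover have "(\<Sum>k<r. (v k $ j) *\<^sub>R u k) \<in> span (u ` {..<r})" for j
    by (intro span_sum span_scale span_base imageI)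
  ultimately have "columns M \<subseteq> span (u ` {..<r})"
    by (auto simp: columns_def)
  then have "rank M \<le> card (u ` {..<r})"
    by (simp add: column_rank_def dim_le_card)
  also have "\<dots> \<le> r"
    using card_image_le[of "{..<r}" u] by simp
  finally show "rank M \<le> r" .
next
  assume "rank M \<le> r"
  obtain B where B: "independent B" "columns M \<subseteq> span B" "card B = dim (columns M)"
    by (rule basis_exists)
  have "finite B"
    using B(1) by (rule independent_imp_finite)
  then obtain h where h: "bij_betw h {..<card B} B"
    by (metis ex_bij_betw_nat_finite atLeast0LessThan)
  have "card B \<le> r"
    using \<open>rank M \<le> r\<close> B(3) by (simp add: column_rank_def)
  have "\<exists>c. column j M = (\<Sum>b\<in>B. c b *\<^sub>R b)" for j
    using B(2) \<open>finite B\<close> by (auto simp: columns_def span_finite)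
  then obtain c where c: "\<And>j. column j M = (\<Sum>b\<in>B. c j b *\<^sub>R b)"
    by metis
  \<comment> \<open>The basis may have fewer than \<open>r\<close> vectors; the remaining terms are set to zero.\<close>
  define u where "u k = (if k < card B then h k else 0)" for k
  define v where "v k = (\<chi> j. c j (h k))" for k
  have "M $ i $ j = (\<Sum>k<r. u k $ i * v k $ j)" for i j
  proof -
    have "M $ i $ j = column j M $ i"
      by (simp add: column_def)
    also have "\<dots> = (\<Sum>b\<in>B. c j b * b $ i)"
      by (simp add: c)
    also have "\<dots> = (\<Sum>k<card B. c j (h k) * h k $ i)"
      by (rule sum.reindex_bij_betw[OF h, symmetric])
    also have "\<dots> = (\<Sum>k<r. u k $ i * v k $ j)"
      using \<open>card B \<le> r\<close> by (intro sum.mono_neutral_cong_left) (auto simp: u_def v_def)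
    finally show ?thesis .
  qed
  then have "M = (\<Sum>k<r. (columnvector (u k) :: real^1^'m) ** transpose (columnvector (v k)))"
    by (simp add: vec_eq_iff outer_nth)
  then show "\<exists>(u :: nat \<Rightarrow> real^'m) (v :: nat \<Rightarrow> real^'n).
    M = (\<Sum>k<r. (columnvector (u k) :: real^1^'m) ** transpose (columnvector (v k)))"
    by blast
qed

text \<open>
  The Kronecker rank is the least length of a decomposition. A decomposition of that length
  becomes one of any greater length by adding products with zero.
\<close>

lemma kron_rank_le_iff:
  fixes X :: "real^('q1::finite \<times> 'q2::finite)^('p1::finite \<times> 'p2::finite)"
  shows "kron_rank X \<le> r \<longleftrightarrow>
    (\<exists>(Y :: nat \<Rightarrow> real^'q1^'p1) (Z :: nat \<Rightarrow> real^'q2^'p2). X = (\<Sum>k<r. Y k \<otimes>\<^sub>K Z k))"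
proof
  assume le: "kron_rank X \<le> r"
  obtain Y :: "nat \<Rightarrow> real^'q1^'p1" and Z :: "nat \<Rightarrow> real^'q2^'p2"
    where X: "X = (\<Sum>k<kron_rank X. Y k \<otimes>\<^sub>K Z k)"
    using kron_rank_attained by blast
  define Y' where "Y' k = (if k < kron_rank X then Y k else 0)" for k
  have "(\<Sum>k<kron_rank X. Y k \<otimes>\<^sub>K Z k) = (\<Sum>k<r. Y' k \<otimes>\<^sub>K Z k)"
    using le by (intro sum.mono_neutral_cong_left) (auto simp: Y'_def kron_def vec_eq_iff)
  with X show "\<exists>(Y :: nat \<Rightarrow> real^'q1^'p1) (Z :: nat \<Rightarrow> real^'q2^'p2). X = (\<Sum>k<r. Y k \<otimes>\<^sub>K Z k)"
    by metis
next
  assume "\<exists>(Y :: nat \<Rightarrow> real^'q1^'p1) (Z :: nat \<Rightarrow> real^'q2^'p2). X = (\<Sum>k<r. Y k \<otimes>\<^sub>K Z k)"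
  then show "kron_rank X \<le> r"
    unfolding kron_rank_def by (rule Least_le)
qed

lemma rearrange_sum_kron:
  "rearrange (\<Sum>k\<in>K. Y k \<otimes>\<^sub>K Z k) = (\<Sum>k\<in>K. vec_cols (Z k) ** transpose (vec_cols (Y k)))"
  by (simp add: linear_sum[OF linear_rearrange] rearrange_kron)

lemma rank_rearrange_le_iff:
  fixes X :: "real^('q1::finite \<times> 'q2::finite)^('p1::finite \<times> 'p2::finite)"
  shows "rank (rearrange X) \<le> r \<longleftrightarrow> kron_rank X \<le> r"
proof
  assume "kron_rank X \<le> r"
  then obtain Y :: "nat \<Rightarrow> real^'q1^'p1" and Z :: "nat \<Rightarrow> real^'q2^'p2"
    where "X = (\<Sum>k<r. Y k \<otimes>\<^sub>K Z k)"
    unfolding kron_rank_le_iff by blast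
  then have "rearrange X = (\<Sum>k<r. vec_cols (Z k) ** transpose (vec_cols (Y k)))"
    by (simp add: rearrange_sum_kron)
  then show "rank (rearrange X) \<le> r"
    unfolding rank_le_iff_sum_outer vec_cols_def by (intro exI)
next
  assume "rank (rearrange X) \<le> r"
  then obtain u :: "nat \<Rightarrow> real^('q2 \<times> 'p2)" and v :: "nat \<Rightarrow> real^('q1 \<times> 'p1)" where
    uv: "rearrange X = (\<Sum>k<r. (columnvector (u k) :: real^1^('q2 \<times> 'p2))
      ** transpose (columnvector (v k)))"
    unfolding rank_le_iff_sum_outer by blast
  define Y :: "nat \<Rightarrow> real^'q1^'p1" where "Y k = (\<chi> i j. v k $ (j, i))" for k
  define Z :: "nat \<Rightarrow> real^'q2^'p2" where "Z k = (\<chi> i j. u k $ (j, i))" for k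
  have "rearrange X = rearrange (\<Sum>k<r. Y k \<otimes>\<^sub>K Z k)"
    by (simp add: uv rearrange_sum_kron Y_def Z_def vec_cols_unstack)
  then have "X = (\<Sum>k<r. Y k \<otimes>\<^sub>K Z k)"
    by (rule injD[OF inj_rearrange])
  then show "kron_rank X \<le> r"
    unfolding kron_rank_le_iff by blast
qed

section \<open>Equivalence of the two problems\<close>

lemma is_arg_min_surj:
  assumes "surj h" and "\<And>x. f x = g (h x)" and "\<And>x. P x \<longleftrightarrow> Q (h x)"
  shows "is_arg_min f P x \<longleftrightarrow> is_arg_min g Q (h x)"
  using assms unfolding is_arg_min_def by (metis surjD)

theorem proposition3p4:
  fixes A :: "real^('n1::finite \<times> 'n2::finite)^('m1::finite \<times> 'm2::finite)"
    and B1 :: "real^'p1^'m1" and B2 :: "real^'p2^'m2"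
    and C1 :: "real^'n1^'q1" and C2 :: "real^'n2^'q2"
    and Xs :: "real^('q1::finite \<times> 'q2::finite)^('p1::finite \<times> 'p2::finite)"
    and r :: nat
  assumes "r > 0"
  shows "is_arg_min
      (\<lambda>X :: real^('q1 \<times> 'q2)^('p1 \<times> 'p2).
         frobenius_norm (A - (B1 \<otimes>\<^sub>K B2) ** X ** (C1 \<otimes>\<^sub>K C2)))
      (\<lambda>X. kron_rank X \<le> r) Xs
    \<longleftrightarrow> is_arg_min
      (\<lambda>Xh :: real^('q1 \<times> 'p1)^('q2 \<times> 'p2).
         frobenius_norm
           (rearrange A - (transpose C2 \<otimes>\<^sub>K B2) ** Xh ** (C1 \<otimes>\<^sub>K transpose B1)))
      (\<lambda>Xh. rank Xh \<le> r) (rearrange Xs)"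
proof (rule is_arg_min_surj[OF surj_rearrange])
  fix X :: "real^('q1 \<times> 'q2)^('p1 \<times> 'p2)"
  show "frobenius_norm (A - (B1 \<otimes>\<^sub>K B2) ** X ** (C1 \<otimes>\<^sub>K C2))
    = frobenius_norm
        (rearrange A - (transpose C2 \<otimes>\<^sub>K B2) ** rearrange X ** (C1 \<otimes>\<^sub>K transpose B1))"
    by (simp add: rearrange_sandwich[symmetric] linear_diff[OF linear_rearrange, symmetric]
        frobenius_norm_rearrange)
  show "kron_rank X \<le> r \<longleftrightarrow> rank (rearrange X) \<le> r"
    by (rule rank_rearrange_le_iff[symmetric])
qed

end
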